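(* Let $T\ge 2$ be an integer, let $i_0>0$ be a real constant, and let $i:\mathbb{R}\to\mathbb{R}$ be a function that is non-negative, monotonically increasing and convex in the domain $[0,\infty)$. Consider the problem $$\min_{x_1,\dots,x_{T-1}}\ \ \sum_{t=1}^{T-1}\frac{1}{i_0+\sum_{s=1}^{t} i(x_s)}+\sum_{t=1}^{T-1}x_t\qquad\text{s.t.}\quad x_k\ge 0,\quad k=1,\dots,T-1.$$ Let $x^*=[x_1^*,\dots,x_{T-1}^*]$ be an optimal solution (a global minimizer) of this problem. Then $x^*$ is either a lazy excitation or an immediate excitation. Moreover, if $$\sum_{t=1}^{T-1}\frac{i'(0)}{[i_0+t\cdot i(0)]^2}>1,$$ then $x^*$ is an immediate excitation.
   Context: A vector $x=[x_1,\dots,x_{T-1}]\in\mathbb{R}^{T-1}$ is called an immediate excitation if $x_1>0$ and $x_2=\cdots=x_{T-1}=0$; it is called a lazy excitation if $x_k=0$ for all $k=1,\dots,T-1$. Monotonically increasing in $[0,\infty)$ means that $0\le a\le b$ implies $i(a)\le i(b)$. The symbol $i'(0)$ denotes the derivative of $i$ at $0$, taken from the right (the right derivative at $0$ exists and is finite because $i$ is convex and monotonically increasing on $[0,\infty)$). *)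

theory Defs
  imports "HOL-Analysis.Analysis"
begin

text \<open>
  Vectors in \<open>\<real>\<^sup>T\<^sup>-\<^sup>1\<close> are represented by functions \<open>nat \<Rightarrow> real\<close>, of which
  only the values at the indices \<open>1, \<dots>, T - 1\<close> are used.
\<close>

definition immediate_excitation :: "nat \<Rightarrow> (nat \<Rightarrow> real) \<Rightarrow> bool" where
  "immediate_excitation T x \<longleftrightarrow> x 1 > 0 \<and> (\<forall>k\<in>{2..T - 1}. x k = 0)"

definition lazy_excitation :: "nat \<Rightarrow> (nat \<Rightarrow> real) \<Rightarrow> bool" where
  "lazy_excitation T x \<longleftrightarrow> (\<forall>k\<in>{1..T - 1}. x k = 0)"

definition feasible :: "nat \<Rightarrow> (nat \<Rightarrow> real) \<Rightarrow> bool" where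
  "feasible T x \<longleftrightarrow> (\<forall>k\<in>{1..T - 1}. x k \<ge> 0)"

definition objective :: "nat \<Rightarrow> real \<Rightarrow> (real \<Rightarrow> real) \<Rightarrow> (nat \<Rightarrow> real) \<Rightarrow> real" where
  "objective T i0 i x =
     (\<Sum>t=1..T - 1. 1 / (i0 + (\<Sum>s=1..t. i (x s)))) + (\<Sum>t=1..T - 1. x t)"

definition right_deriv :: "(real \<Rightarrow> real) \<Rightarrow> real \<Rightarrow> real" where
  "right_deriv f a = (THE D. (f has_real_derivative D) (at_right a))"

lemma right_deriv_eqI:
  assumes "(f has_real_derivative D) (at_right a)"
  shows "right_deriv f a = D"
  unfolding right_deriv_def
proof (rule the_equality)
  fix E assume "(f has_real_derivative E) (at_right a)"
  with assms show "E = D"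
    unfolding has_field_derivative_iff using tendsto_unique trivial_limit_at_right_real by blast
qed (fact assms)

text \<open>Monotonicity and convexity on the half-line make the derivative from the right at 0 exist.\<close>

lemma has_right_deriv_0:
  fixes f :: "real \<Rightarrow> real"
  assumes mono: "mono_on {0..} f" and conv: "convex_on {0..} f"
  shows "(f has_real_derivative right_deriv f 0) (at_right 0)"
proof -
  define q where "q = (\<lambda>x. (f x - f 0) / x)"
  define L where "L = Inf (q ` {0<..})"
  have nonneg: "q x \<ge> 0" if "x > 0" for x
    using that mono_onD[OF mono, of 0 x] by (simp add: q_def)
  then have bdd: "bdd_below (q ` {0<..})"
    by (auto intro!: bdd_belowI[of _ 0])
  have q_mono: "q x \<le> q y" if "0 < x" "x \<le> y" for x y
  proof -
    have "f ((1 - x / y) *\<^sub>R 0 + (x / y) *\<^sub>R y) \<le> (1 - x / y) * f 0 + (x / y) * f y"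
      using that by (intro convex_onD[OF conv]) auto
    then have "f x - f 0 \<le> x * ((f y - f 0) / y)"
      using that by (simp add: algebra_simps diff_divide_distrib)
    then show ?thesis
      using that by (simp add: q_def pos_divide_le_eq mult.commute)
  qed
  have "(q \<longlongrightarrow> L) (at_right 0)"
  proof (rule order_tendstoI)
    fix c assume "c < L"
    have "c < q x" if "x > 0" for x
    proof -
      have "L \<le> q x"
        unfolding L_def using that by (intro cInf_lower[OF _ bdd]) simp
      with \<open>c < L\<close> show ?thesis
        by simp
    qed
    then show "eventually (\<lambda>x. c < q x) (at_right 0)"
      by (auto simp: eventually_at_right_field intro: exI[of _ 1])
  next
    fix c assume "L < c"
    then obtain y where y: "y > 0" "q y < c"
      using cInf_less_iff[OF _ bdd, of c] by (auto simp: L_def)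
    show "eventually (\<lambda>x. q x < c) (at_right 0)"
      unfolding eventually_at_right_field
    proof (intro exI[of _ y] conjI allI impI)
      fix x assume "0 < x" "x < y"
      then have "q x \<le> q y"
        by (intro q_mono) auto
      with y show "q x < c"
        by simp
    qed (fact y)
  qed
  then have "(f has_real_derivative L) (at_right 0)"
    by (simp add: has_field_derivative_iff q_def)
  then show ?thesis
    using right_deriv_eqI by metis
qed

end

(* Spread-out excitation is never better than an impulse of the same total X at time 1: by convexity
   i (x s) - i 0 <= (x s / X) * (i X - i 0), so every partial sum of the i (x s) is dominated by that
   of the impulse, and strictly so at t = 1 if i X > i 0 and x 1 < X. If i X = i 0, doing nothing is
   strictly cheaper. Along impulses of size a, the objective has right derivative
   1 - (sum of i'(0) / (i0 + t i(0))^2) at a = 0, so a negative derivative rules out laziness. *)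

theory Submission
  imports Defs
begin

text \<open>Taking \<open>a = 0\<close> gives the lazy excitation, so \<open>x\<close> only ever has
  to be compared with this one-parameter family.\<close>

definition impulse :: "real \<Rightarrow> nat \<Rightarrow> real" where
  "impulse a = (\<lambda>_. 0)(1 := a)"

lemma feasible_impulse: "a \<ge> 0 \<Longrightarrow> feasible T (impulse a)"
  by (simp add: feasible_def impulse_def)

text \<open>Only the increment \<open>i a - i 0\<close> depends on \<open>a\<close>; it is the
  quantity that the chord bound controls and that is differentiated at 0. With the identity for
  \<open>i\<close>, the same formula gives the total of an impulse.\<close>

lemma sum_impulse:
  assumes "t \<ge> 1"
  shows "(\<Sum>s=1..t. i (impulse a s)) = real t * i 0 + (i a - i 0)"
  using assms by (simp add: impulse_def sum.atLeast_Suc_atMost of_nat_diff algebra_simps)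

lemma objective_impulse:
  assumes "T \<ge> 2"
  shows "objective T i0 i (impulse a) =
    (\<Sum>t=1..T - 1. 1 / (i0 + (real t * i 0 + (i a - i 0)))) + a"
proof -
  have "(\<Sum>t=1..T - 1. impulse a t) = a"
    using assms sum_impulse[of "T - 1" "\<lambda>x. x" a] by simp
  then show ?thesis
    unfolding objective_def
    by (intro arg_cong2[where f = "(+)"] sum.cong) (simp_all only: sum_impulse atLeastAtMost_iff)
qed

text \<open>The two functions may differ outside \<open>{1..T - 1}\<close>, but the objective reads
  no other index.\<close>

lemma objective_lazy:
  assumes "lazy_excitation T x"
  shows "objective T i0 i x = objective T i0 i (impulse 0)"
proof -
  have "x s = impulse 0 s" if "s \<in> {1..T - 1}" for s
    using assms that by (simp add: lazy_excitation_def impulse_def)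
  then show ?thesis
    unfolding objective_def
    by (intro arg_cong2[where f = "(+)"] sum.cong arg_cong2[where f = "(/)"]) auto
qed

text \<open>Write \<open>a\<close> as the convex combination of 0 and \<open>X\<close> in which
  \<open>X\<close> has weight \<open>a / X\<close>.\<close>

lemma convex_on_chord_0:
  fixes i :: "real \<Rightarrow> real"
  assumes "convex_on {0..} i" "0 \<le> a" "a \<le> X" "X > 0"
  shows "i a - i 0 \<le> a / X * (i X - i 0)"
proof -
  have "i ((1 - a / X) *\<^sub>R 0 + (a / X) *\<^sub>R X) \<le> (1 - a / X) * i 0 + (a / X) * i X"
    using assms by (intro convex_onD) auto
  then show ?thesis
    using assms by (simp add: algebra_simps)
qed

lemma objective_impulse_less:
  fixes i :: "real \<Rightarrow> real"
  assumes T: "T \<ge> 2" and i0: "i0 > 0" and nonneg: "\<And>a. a \<ge> 0 \<Longrightarrow> i a \<ge> 0"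
    and mono: "mono_on {0..} i" and conv: "convex_on {0..} i"
    and x: "feasible T x" and k: "k \<in> {2..T - 1}" "x k > 0"
  shows "\<exists>a\<ge>0. objective T i0 i (impulse a) < objective T i0 i x"
proof -
  have T1: "1 \<le> T - 1"
    using T by simp
  define X where "X = (\<Sum>s=1..T - 1. x s)"
  have x0: "x s \<ge> 0" if "s \<in> {1..T - 1}" for s
    using x that by (auto simp: feasible_def)
  have part: "(\<Sum>s=1..t. x s) \<le> X" if "t \<le> T - 1" for t
    unfolding X_def using that x0 by (intro sum_mono2) auto
  \<comment> \<open>Since \<open>k\<close> is at least 2, the indices 1 and \<open>k\<close> are
    distinct, so the positive \<open>x k\<close> keeps \<open>x 1\<close> strictly below the
    total.\<close>
  have "x 1 + x k = (\<Sum>s\<in>{1, k}. x s)"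
    using k by simp
  also have "\<dots> \<le> X"
    unfolding X_def using k x0 by (intro sum_mono2) auto
  finally have x1: "x 1 < X"
    using k by simp
  then have X: "X > 0"
    using x0[of 1] k by fastforce
  have le_X: "x s \<le> X" if "s \<in> {1..T - 1}" for s
    unfolding X_def using that x0 by (intro member_le_sum) auto
  have iX: "i X \<ge> i 0"
    using X mono_onD[OF mono, of 0 X] by simp
  have pos: "i0 + (\<Sum>s=1..t. i (x s)) > 0" if "t \<le> T - 1" for t
    using that i0 x0 nonneg by (intro add_pos_nonneg sum_nonneg) auto
  \<comment> \<open>Adding the chord bounds for the single \<open>x s\<close> produces the
    coefficient \<open>(\<Sum>s=1..t. x s) / X\<close>, which is at most 1.\<close>
  have chord: "(\<Sum>s=1..t. i (x s)) \<le> real t * i 0 + (\<Sum>s=1..t. x s) / X * (i X - i 0)"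
    if "t \<le> T - 1" for t
  proof -
    have "(\<Sum>s=1..t. i (x s) - i 0) \<le> (\<Sum>s=1..t. x s / X * (i X - i 0))"
      using that x0 le_X X by (intro sum_mono convex_on_chord_0[OF conv]) auto
    then show ?thesis
      by (simp add: sum_subtractf sum_distrib_right sum_divide_distrib)
  qed
  have dom: "(\<Sum>s=1..t. i (x s)) \<le> real t * i 0 + (i X - i 0)" if "t \<le> T - 1" for t
  proof -
    have "(\<Sum>s=1..t. x s) / X * (i X - i 0) \<le> 1 * (i X - i 0)"
      using part[OF that] X iX by (intro mult_right_mono) auto
    then show ?thesis
      using chord[OF that] by simp
  qed
  show ?thesis
  proof (cases "i X = i 0")
    case True
    \<comment> \<open>When \<open>i X = i 0\<close>, \<open>dom\<close> bounds each partial sum by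
      \<open>real t * i 0\<close>. Hence no fraction grows when the input is dropped, and the cost
      \<open>X > 0\<close> is saved.\<close>
    have "1 / (i0 + (real t * i 0 + (i 0 - i 0))) \<le> 1 / (i0 + (\<Sum>s=1..t. i (x s)))"
      if "t \<in> {1..T - 1}" for t
      using that dom[of t] pos[of t] True by (intro divide_left_mono mult_pos_pos) auto
    then have "objective T i0 i (impulse 0) + X \<le> objective T i0 i x"
      unfolding objective_impulse[OF T] unfolding objective_def X_def by (auto intro: sum_mono)
    with X show ?thesis
      by (intro exI[of _ 0]) simp
  next
    case False
    then have iX': "i X > i 0"
      using iX by simp
    have le: "1 / (i0 + (real t * i 0 + (i X - i 0))) \<le> 1 / (i0 + (\<Sum>s=1..t. i (x s)))"
      if "t \<in> {1..T - 1}" for t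
      using that dom[of t] pos[of t] by (intro divide_left_mono mult_pos_pos) auto
    \<comment> \<open>At \<open>t = 1\<close> the chord coefficient is \<open>x 1 / X\<close>, which
      is less than 1; one strict summand suffices.\<close>
    have "x 1 / X * (i X - i 0) < 1 * (i X - i 0)"
      using iX' x1 X by (intro mult_strict_right_mono) auto
    then have "(\<Sum>s=1..1. i (x s)) < real 1 * i 0 + (i X - i 0)"
      using chord[OF T1] by simp
    then have "1 / (i0 + (real 1 * i 0 + (i X - i 0))) < 1 / (i0 + (\<Sum>s=1..1. i (x s)))"
      using pos[OF T1] dom[OF T1] by (intro divide_strict_left_mono mult_pos_pos) auto
    then have "objective T i0 i (impulse X) < objective T i0 i x"
      unfolding objective_impulse[OF T] unfolding objective_def X_def[symmetric]
      using T le by (intro add_strict_right_mono sum_strict_mono_ex1) (auto intro!: bexI[of _ 1])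
    with X show ?thesis
      by (intro exI[of _ X]) simp
  qed
qed

lemma objective_impulse_less_lazy:
  fixes i :: "real \<Rightarrow> real"
  assumes T: "T \<ge> 2" and i0: "i0 > 0" and nonneg: "i 0 \<ge> 0"
    and deriv: "(i has_real_derivative D) (at_right 0)"
    and D: "(\<Sum>t=1..T - 1. D / (i0 + real t * i 0)\<^sup>2) > 1"
  shows "\<exists>a\<ge>0. objective T i0 i (impulse a) < objective T i0 i (impulse 0)"
proof -
  let ?f = "\<lambda>a. objective T i0 i (impulse a)"
  have pos: "i0 + real t * i 0 > 0" for t
    using i0 nonneg by (intro add_pos_nonneg) auto
  \<comment> \<open>At \<open>a = 0\<close> the increment \<open>i a - i 0\<close> vanishes, which
    leaves the square of \<open>i0 + real t * i 0\<close> in the denominator.\<close>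
  have "((\<lambda>a. 1 / (i0 + (real t * i 0 + (i a - i 0)))) has_real_derivative
      - (D / (i0 + real t * i 0)\<^sup>2)) (at_right 0)" for t
    using pos[of t] by (auto intro!: derivative_eq_intros deriv simp: power2_eq_square)
  then have "(?f has_real_derivative (\<Sum>t=1..T - 1. - (D / (i0 + real t * i 0)\<^sup>2)) + 1) (at_right 0)"
    unfolding objective_impulse[OF T] by (intro DERIV_add DERIV_sum DERIV_ident)
  moreover have "(\<Sum>t=1..T - 1. - (D / (i0 + real t * i 0)\<^sup>2)) + 1 < 0"
    using D by (simp add: sum_negf)
  \<comment> \<open>A negative right derivative makes the objective drop for every impulse size
    strictly between 0 and \<open>d\<close>; the witness below is \<open>d / 2\<close>.\<close>
  ultimately obtain d where "d > 0" "\<And>h. h > 0 \<Longrightarrow> 0 + h \<in> {0<..} \<Longrightarrow> h < d \<Longrightarrow> ?f (0 + h) < ?f 0"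
    using has_real_derivative_neg_dec_right[of ?f _ 0 "{0<..}"] by metis
  from this(1) this(2)[of "d / 2"] show ?thesis
    by (intro exI[of _ "d / 2"]) simp
qed

theorem theorem1:
  fixes T :: nat and i0 :: real and i :: "real \<Rightarrow> real" and x :: "nat \<Rightarrow> real"
  assumes "T \<ge> 2"
    and "i0 > 0"
    and "\<And>a. a \<ge> 0 \<Longrightarrow> i a \<ge> 0"
    and "mono_on {0..} i"
    and "convex_on {0..} i"
    and "is_arg_min (objective T i0 i) (feasible T) x"
  shows "(lazy_excitation T x \<or> immediate_excitation T x) \<and>
    ((\<Sum>t=1..T - 1. right_deriv i 0 / (i0 + real t * i 0)\<^sup>2) > 1 \<longrightarrow> immediate_excitation T x)"
proof -
  \<comment> \<open>Global optimality enters only through comparison with impulses of size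
    \<open>a \<ge> 0\<close>, all of which are feasible.\<close>
  have x: "feasible T x"
    and min: "\<not> (\<exists>a\<ge>0. objective T i0 i (impulse a) < objective T i0 i x)"
    using assms(6) feasible_impulse by (auto simp: is_arg_min_def)
  have "x k = 0" if "k \<in> {2..T - 1}" for k
  proof -
    have "x k \<ge> 0"
      using x that by (simp add: feasible_def)
    moreover have "\<not> x k > 0"
      using objective_impulse_less[OF assms(1-5) x that] min by blast
    ultimately show ?thesis
      by simp
  qed
  moreover have "x 1 \<ge> 0"
    using x assms(1) by (simp add: feasible_def)
  ultimately have either: "lazy_excitation T x \<or> immediate_excitation T x"
    unfolding lazy_excitation_def immediate_excitation_def
    by (metis One_nat_def Suc_1 atLeastAtMost_iff le_antisym not_less_eq_eq order_less_le)
  moreover have "\<not> lazy_excitation T x"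
    if "(\<Sum>t=1..T - 1. right_deriv i 0 / (i0 + real t * i 0)\<^sup>2) > 1"
    using objective_impulse_less_lazy[OF assms(1,2) assms(3)[of 0] has_right_deriv_0[OF assms(4,5)] that]
      objective_lazy[of T x i0 i] min by auto
  ultimately show ?thesis
    by blast
qed

end
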